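(* Let $H$ be a graph such that $H$ is an induced subgraph of $W_4$, or of $K_5^-$, or of $K_{2,q}$ for some $q\in\mathbb{N}$, or of $K_{2,q}^+$ for some $q\in\mathbb{N}$. Then the class of $H$-induced-minor-free graphs is $\chi$-bounded.
   Context: All graphs are finite, simple and undirected. $\chi(G)$ is the chromatic number and $\omega(G)$ the clique number of $G$. A graph class $\mathcal{G}$ is $\chi$-bounded if there is a function $f:\mathbb{N}\to\mathbb{N}$ such that for every $G\in\mathcal{G}$ and every induced subgraph $G'$ of $G$, $\chi(G')\le f(\omega(G'))$. $H$ is an induced minor of $G$ if a graph isomorphic to $H$ can be obtained from $G$ by a sequence of vertex deletions and edge contractions (with resulting parallel edges identified); $G$ is $H$-induced-minor-free if this is not the case. "Is an induced subgraph of" is understood up to isomorphism. $W_4$ (the 4-wheel) is obtained from the 4-cycle $C_4$ by adding a new vertex adjacent to all vertices of $C_4$. $K_5^-$ is $K_5$ minus an edge. $K_{2,q}$ is the complete bipartite graph with parts of sizes $2$ and $q$; for $q\ge 1$, $K_{2,q}^+$ is obtained from $K_{2,q}$ by adding an edge between the two vertices of the part of size $2$. *)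

theory Defs
  imports "Graph_Theory.Graph_Theory"
begin

text \<open>
  Finite simple undirected graphs are the loopless finite symmetric pair digraphs of
  \<^locale>\<open>pair_graph\<close>; an edge $uv$ is the pair of arcs $(u,v)$, $(v,u)$.
  The null graph is allowed.
\<close>

section \<open>Isomorphism\<close>

definition graph_iso :: "'a pair_pre_digraph \<Rightarrow> 'b pair_pre_digraph \<Rightarrow> bool" where
  "graph_iso G H \<longleftrightarrow> digraph_iso (with_proj G) (with_proj H)"

definition is_induced_subgraph_of :: "'a pair_pre_digraph \<Rightarrow> 'b pair_pre_digraph \<Rightarrow> bool" where
  "is_induced_subgraph_of H G \<longleftrightarrow>
     (\<exists>G'. induced_subgraph (with_proj G') (with_proj G) \<and> graph_iso G' H)"

lemma graph_iso_iff:
  assumes "pair_wf_digraph G"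
  shows "graph_iso G H \<longleftrightarrow>
    (\<exists>f. bij_betw f (pverts G) (pverts H) \<and> parcs H = map_prod f f ` parcs G)"
proof
  interpret pair_wf_digraph G by fact
  assume "graph_iso G H"
  then obtain h where h: "digraph_isomorphism h" "with_proj H = app_iso h (with_proj G)"
    by (auto simp: graph_iso_def digraph_iso_def)
  let ?f = "iso_verts h"
  have V: "pverts H = ?f ` pverts G" and A: "parcs H = iso_arcs h ` parcs G"
    and t: "iso_tail h = fst" "iso_head h = snd"
    using h(2) by (simp_all add: app_iso_def with_proj_def)
  have "iso_arcs h a = map_prod ?f ?f a" if "a \<in> parcs G" for a
    using h(1) that t by (cases a) (force simp: digraph_isomorphism_def prod_eq_iff)
  with A have "parcs H = map_prod ?f ?f ` parcs G" by simp
  moreover have "inj_on ?f (pverts G)"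
    using h(1) by (simp add: digraph_isomorphism_def)
  ultimately show "\<exists>f. bij_betw f (pverts G) (pverts H) \<and> parcs H = map_prod f f ` parcs G"
    using V by (auto simp: bij_betw_def)
next
  interpret pair_wf_digraph G by fact
  assume "\<exists>f. bij_betw f (pverts G) (pverts H) \<and> parcs H = map_prod f f ` parcs G"
  then obtain f where f: "inj_on f (pverts G)" "pverts H = f ` pverts G"
    "parcs H = map_prod f f ` parcs G" by (auto simp: bij_betw_def)
  let ?h = "\<lparr>iso_verts = f, iso_arcs = map_prod f f, iso_head = snd, iso_tail = fst\<rparr>"
  have "inj_on (map_prod f f) (parcs G)"
    using f(1) by (auto simp: inj_on_def) (metis in_arcsD1 in_arcsD2)+
  then have "digraph_isomorphism ?h"
    using f wf_digraph by (simp add: digraph_isomorphism_def)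
  moreover have "with_proj H = app_iso ?h (with_proj G)"
    using f by (simp add: app_iso_def with_proj_def)
  ultimately show "graph_iso G H"
    unfolding graph_iso_def digraph_iso_def by blast
qed


section \<open>Induced minors\<close>

definition delete_vertex :: "'a pair_pre_digraph \<Rightarrow> 'a \<Rightarrow> 'a pair_pre_digraph" where
  "delete_vertex G v = \<lparr> pverts = pverts G - {v},
     parcs = {(x, y) \<in> parcs G. x \<noteq> v \<and> y \<noteq> v} \<rparr>"

lemma with_proj_delete_vertex: "with_proj (delete_vertex G v) = pre_digraph.del_vert (with_proj G) v"
  by (auto simp: with_proj_def pre_digraph.del_vert_def delete_vertex_def)

text \<open>
  The vertex resulting from the contraction of $uv$ keeps the name $u$. Parallel edges are
  identified because arcs form a set; removing the diagonal discards the contracted edge itself.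
\<close>
definition contract_edge :: "'a pair_pre_digraph \<Rightarrow> 'a \<Rightarrow> 'a \<Rightarrow> 'a pair_pre_digraph" where
  "contract_edge G u v = \<lparr> pverts = pverts G - {v},
     parcs = map_prod (id(v := u)) (id(v := u)) ` parcs G - Id \<rparr>"

inductive induced_minor_step :: "'a pair_pre_digraph \<Rightarrow> 'a pair_pre_digraph \<Rightarrow> bool" where
  delete: "v \<in> pverts G \<Longrightarrow> induced_minor_step G (delete_vertex G v)"
| contract: "(u, v) \<in> parcs G \<Longrightarrow> induced_minor_step G (contract_edge G u v)"

definition is_induced_minor_of :: "'a pair_pre_digraph \<Rightarrow> 'b pair_pre_digraph \<Rightarrow> bool" where
  "is_induced_minor_of H G \<longleftrightarrow> (\<exists>G'. induced_minor_step\<^sup>*\<^sup>* G G' \<and> graph_iso G' H)"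

text \<open>
  Vertices range over the type \<^typ>\<open>'b\<close>; for any infinite \<^typ>\<open>'b\<close> (such as \<^typ>\<open>nat\<close>)
  this set contains an isomorphic copy of every finite graph without $H$ as an induced minor.
\<close>
definition induced_minor_free_graphs :: "'a pair_pre_digraph \<Rightarrow> 'b pair_pre_digraph set" where
  "induced_minor_free_graphs H = {G. pair_graph G \<and> \<not> is_induced_minor_of H G}"

lemma pair_graphI:
  assumes "finite (pverts G)" "parcs G \<subseteq> pverts G \<times> pverts G" "sym (parcs G)" "irrefl (parcs G)"
  shows "pair_graph G"
proof -
  have "finite (parcs G)"
    using assms by (blast intro: finite_subset)
  then show ?thesis
    using assms by unfold_locales (auto simp: symmetric_def irrefl_def)
qed

lemma pair_graph_iff:
  "pair_graph G \<longleftrightarrow> finite (pverts G) \<and> parcs G \<subseteq> pverts G \<times> pverts G \<and>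
     sym (parcs G) \<and> irrefl (parcs G)"
proof
  assume "pair_graph G"
  then interpret pair_graph G .
  show "finite (pverts G) \<and> parcs G \<subseteq> pverts G \<times> pverts G \<and> sym (parcs G) \<and> irrefl (parcs G)"
    by (auto intro: symI in_arcsD1 in_arcsD2 arcs_symmetric simp: irrefl_def dest: no_loops')
qed (blast intro: pair_graphI)

lemma pair_graph_induced_minor_step:
  assumes "induced_minor_step G G'" "pair_graph G"
  shows "pair_graph G'"
  using assms
proof cases
  case (delete v)
  then show ?thesis
    using assms(2) by (auto simp: pair_graph_iff delete_vertex_def sym_def irrefl_def)
next
  case (contract u v)
  then have "u \<noteq> v" "u \<in> pverts G"
    using assms(2) by (auto simp: pair_graph_iff irrefl_def)
  moreover have "sym (map_prod (id(v := u)) (id(v := u)) ` parcs G)"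
  proof (rule symI)
    fix x y assume "(x, y) \<in> map_prod (id(v := u)) (id(v := u)) ` parcs G"
    then obtain a b where "(a, b) \<in> parcs G" "x = (id(v := u)) a" "y = (id(v := u)) b"
      by auto
    moreover from this have "(b, a) \<in> parcs G"
      using assms(2) by (simp add: pair_graph_iff sym_def)
    ultimately show "(y, x) \<in> map_prod (id(v := u)) (id(v := u)) ` parcs G"
      by (metis map_prod_imageI)
  qed
  then have "sym (map_prod (id(v := u)) (id(v := u)) ` parcs G - Id)"
    by (auto simp: sym_def)
  ultimately show ?thesis
    using assms(2) contract(1) unfolding pair_graph_iff contract_edge_def
    by (auto simp: irrefl_def split: if_splits)
qed


section \<open>Chromatic number, clique number and chi-boundedness\<close>

definition proper_coloring :: "'a pair_pre_digraph \<Rightarrow> nat \<Rightarrow> ('a \<Rightarrow> nat) \<Rightarrow> bool" where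
  "proper_coloring G k c \<longleftrightarrow>
     c ` pverts G \<subseteq> {..<k} \<and> (\<forall>(u, v) \<in> parcs G. c u \<noteq> c v)"

definition chromatic_number :: "'a pair_pre_digraph \<Rightarrow> nat" where
  "chromatic_number G = (LEAST k. \<exists>c. proper_coloring G k c)"

definition clique :: "'a pair_pre_digraph \<Rightarrow> 'a set \<Rightarrow> bool" where
  "clique G K \<longleftrightarrow> K \<subseteq> pverts G \<and> (\<forall>u\<in>K. \<forall>v\<in>K. u \<noteq> v \<longrightarrow> (u, v) \<in> parcs G)"

definition clique_number :: "'a pair_pre_digraph \<Rightarrow> nat" where
  "clique_number G = Max {card K | K. clique G K}"

definition chi_bounded :: "'a pair_pre_digraph set \<Rightarrow> bool" where
  "chi_bounded \<G> \<longleftrightarrow>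
     (\<exists>f :: nat \<Rightarrow> nat. \<forall>G\<in>\<G>. \<forall>G'. induced_subgraph (with_proj G') (with_proj G) \<longrightarrow>
        chromatic_number G' \<le> f (clique_number G'))"

lemma proper_coloring_chromatic_number:
  assumes "pair_graph G"
  shows "\<exists>c. proper_coloring G (chromatic_number G) c"
proof -
  from assms obtain c n where c: "c ` pverts G = {i::nat. i < n}" "inj_on c (pverts G)"
    using finite_imp_inj_to_nat_seg by (metis pair_graph_iff)
  then have "proper_coloring G n c"
    using assms by (auto simp: proper_coloring_def pair_graph_iff irrefl_def inj_on_def)
      (metis SigmaE2 subsetD)
  then show ?thesis
    unfolding chromatic_number_def by (intro LeastI) blast
qed


section \<open>Particular graphs\<close>

text \<open>The 4-cycle 0, 1, 2, 3 with hub 4.\<close>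
definition W4 :: "nat pair_pre_digraph" where
  "W4 = \<lparr> pverts = {0, 1, 2, 3, 4},
     parcs = ({(0, 1), (1, 2), (2, 3), (3, 0)} \<union> {4} \<times> {0, 1, 2, 3})\<^sup>s \<rparr>"

definition K5_minus :: "nat pair_pre_digraph" where
  "K5_minus = \<lparr> pverts = {..<5},
     parcs = {(u, v). u < 5 \<and> v < 5 \<and> u \<noteq> v} - {(0, 1), (1, 0)} \<rparr>"

definition K2q :: "nat \<Rightarrow> nat pair_pre_digraph" where
  "K2q q = \<lparr> pverts = {0, 1} \<union> {2..<q + 2}, parcs = ({0, 1} \<times> {2..<q + 2})\<^sup>s \<rparr>"

definition K2q_plus :: "nat \<Rightarrow> nat pair_pre_digraph" where
  "K2q_plus q = \<lparr> pverts = pverts (K2q q), parcs = parcs (K2q q) \<union> {(0, 1), (1, 0)} \<rparr>"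

lemma complete_bipartite_K2q: "complete_bipartite_digraph 2 q (with_proj (K2q q))"
  unfolding complete_bipartite_digraph_pair_def
proof (intro conjI)
  have "card {0, 1 :: nat} = 2" "card {2..<q + 2} = q" by simp_all
  moreover have "pverts (K2q q) = {0, 1} \<union> {2..<q + 2}" "{0, 1} \<inter> {2..<q + 2} = {}"
    "parcs (K2q q) = {0, 1} \<times> {2..<q + 2} \<union> {2..<q + 2} \<times> {0, 1}"
    by (force simp: K2q_def symcl_def)+
  ultimately show "\<exists>U V. pverts (K2q q) = U \<union> V \<and> U \<inter> V = {} \<and> card U = 2 \<and> card V = q \<and>
      parcs (K2q q) = U \<times> V \<union> V \<times> U"
    by blast
qed (simp add: K2q_def)

lemma complete_K5_minus_plus_edge:
  "complete_digraph 5 (with_proj (K5_minus\<lparr> parcs := parcs K5_minus \<union> {(0, 1), (1, 0)} \<rparr>))"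
  unfolding complete_digraph_pair_def by (auto simp: K5_minus_def)

lemma pair_graph_particular:
  "pair_graph W4" "pair_graph K5_minus" "pair_graph (K2q q)" "pair_graph (K2q_plus q)"
  by (auto simp: pair_graph_iff W4_def K5_minus_def K2q_def K2q_plus_def symcl_def sym_def irrefl_def)

end

theory Submission
  imports "HOL-Library.Ramsey" Defs
begin

text \<open>
  All four families consist of induced minors of cones over $K_{2,r}$: deleting the apex leaves
  $K_{2,r}$, the wheel is the cone over $K_{2,2}$, contracting an edge of $K_{2,q+1}$ gives
  $K_{2,q}^+$, and $K_5^-$ is the cone over $K_{2,2}^+$. So it suffices to bound $\chi$ in terms of
  $\omega$ for graphs that do not contain the cone over a fixed $K_{2,r}$ as an induced minor.

  The cone is easy to find in a distance layering. The ball around a root is connected and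
  contains a neighbour of every vertex of the next layer, so it can be contracted to an apex
  over that layer. Hence no layer contains $K_{2,r}$ as an induced minor, and as edges join only
  equal or consecutive layers, the chromatic number is at most twice that of the worst layer
  (\<open>cone_free_colorable\<close>).

  It remains to colour graphs without $K_{2,r}$. They are degenerate with a bound that depends
  only on \<open>r\<close> and $\omega$ (\<open>K2r_free_small_degree\<close>): the two sides of a minimal separator contract
  to the part of size two of a $K_{2,s}$ whose other part is a stable set in the separator, so
  Ramsey's theorem bounds the size of minimal separators, and the argument that finds a
  simplicial vertex of a chordal graph then finds a vertex of small degree.

  Induced minors are exhibited by models, that is, by connected disjoint branch sets with the
  prescribed adjacencies; \<open>model_is_induced_minor\<close> turns a model into a sequence of
  deletions and contractions.
\<close>

section \<open>Connected sets\<close>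

text \<open>
  Connectedness is expressed by edges across cuts instead of paths, because a cut of a contracted
  graph lifts directly to a cut of the original one.
\<close>
definition connected_set :: "('a \<times> 'a) set \<Rightarrow> 'a set \<Rightarrow> bool" where
  "connected_set E B \<longleftrightarrow> B \<noteq> {} \<and>
     (\<forall>X. X \<subset> B \<and> X \<noteq> {} \<longrightarrow> (\<exists>x\<in>X. \<exists>y\<in>B - X. (x, y) \<in> E))"

definition touches :: "('a \<times> 'a) set \<Rightarrow> 'a set \<Rightarrow> 'a set \<Rightarrow> bool" where
  "touches E X Y \<longleftrightarrow> (\<exists>x\<in>X. \<exists>y\<in>Y. (x, y) \<in> E)"

lemma touches_sym: "sym E \<Longrightarrow> touches E X Y \<longleftrightarrow> touches E Y X"
  by (auto simp: touches_def sym_def)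

lemma touches_insert_left: "touches E (insert x X) Y \<longleftrightarrow> touches E {x} Y \<or> touches E X Y"
  by (auto simp: touches_def)

lemma touches_insert_right: "touches E Y (insert x X) \<longleftrightarrow> touches E Y {x} \<or> touches E Y X"
  by (auto simp: touches_def)

lemma connected_set_singleton: "connected_set E {x}"
  by (auto simp: connected_set_def)

lemma connected_set_Un_neighbors:
  assumes "sym E" "connected_set E B" "\<And>y. y \<in> N \<Longrightarrow> touches E B {y}"
  shows "connected_set E (B \<union> N)"
  unfolding connected_set_def
proof (intro conjI allI impI)
  show "B \<union> N \<noteq> {}" using assms(2) by (auto simp: connected_set_def)
next
  fix X assume X: "X \<subset> B \<union> N \<and> X \<noteq> {}"
  consider "X \<inter> B = {}" | "B \<subseteq> X" | "X \<inter> B \<noteq> {}" "X \<inter> B \<subset> B" by blast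
  then show "\<exists>x\<in>X. \<exists>y\<in>B \<union> N - X. (x, y) \<in> E"
  proof cases
    case 1
    then obtain x where "x \<in> X" "x \<in> N" using X by blast
    with assms(3) obtain y where "y \<in> B" "(y, x) \<in> E" by (auto simp: touches_def)
    moreover from this have "(x, y) \<in> E" using \<open>sym E\<close> by (blast dest: symD)
    moreover have "y \<in> B \<union> N - X" using 1 \<open>y \<in> B\<close> by blast
    ultimately show ?thesis using \<open>x \<in> X\<close> by blast
  next
    case 2
    then obtain y where "y \<in> N" "y \<notin> X" using X by blast
    with assms(3) 2 show ?thesis by (fastforce simp: touches_def)
  next
    case 3
    then show ?thesis using assms(2) unfolding connected_set_def by blast
  qed
qed


section \<open>Induced minor models\<close>

definition induced_minor_model ::
    "'b pair_pre_digraph \<Rightarrow> 'a pair_pre_digraph \<Rightarrow> ('b \<Rightarrow> 'a set) \<Rightarrow> bool" where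
  "induced_minor_model H G \<phi> \<longleftrightarrow>
     (\<forall>h\<in>pverts H. \<phi> h \<subseteq> pverts G \<and> connected_set (parcs G) (\<phi> h)) \<and>
     (\<forall>h\<in>pverts H. \<forall>h'\<in>pverts H. h \<noteq> h' \<longrightarrow>
        \<phi> h \<inter> \<phi> h' = {} \<and> (touches (parcs G) (\<phi> h) (\<phi> h') \<longleftrightarrow> (h, h') \<in> parcs H))"

lemma connected_set_delete_vertex:
  assumes "connected_set (parcs G) B" "v \<notin> B"
  shows "connected_set (parcs (delete_vertex G v)) B"
  unfolding connected_set_def
proof (intro conjI allI impI)
  show "B \<noteq> {}" using assms by (simp add: connected_set_def)
next
  fix X assume "X \<subset> B \<and> X \<noteq> {}"
  then obtain x y where xy: "x \<in> X" "y \<in> B - X" "(x, y) \<in> parcs G"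
    using assms(1) unfolding connected_set_def by blast
  then have "x \<noteq> v" "y \<noteq> v" using assms(2) \<open>X \<subset> B \<and> X \<noteq> {}\<close> by auto
  with xy show "\<exists>x\<in>X. \<exists>y\<in>B - X. (x, y) \<in> parcs (delete_vertex G v)"
    by (auto simp: delete_vertex_def)
qed

lemma connected_set_contract_other:
  assumes "connected_set (parcs G) B" "v \<notin> B"
  shows "connected_set (parcs (contract_edge G u v)) B"
  unfolding connected_set_def
proof (intro conjI allI impI)
  show "B \<noteq> {}" using assms by (simp add: connected_set_def)
next
  fix X assume "X \<subset> B \<and> X \<noteq> {}"
  then obtain x y where xy: "x \<in> X" "y \<in> B - X" "(x, y) \<in> parcs G"
    using assms(1) unfolding connected_set_def by blast
  then have "x \<noteq> v" "y \<noteq> v" "x \<noteq> y" using assms(2) \<open>X \<subset> B \<and> X \<noteq> {}\<close> by auto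
  with xy(3) have "(x, y) \<in> parcs (contract_edge G u v)"
    unfolding contract_edge_def by (auto intro!: image_eqI[of _ _ "(x, y)"])
  with xy show "\<exists>x\<in>X. \<exists>y\<in>B - X. (x, y) \<in> parcs (contract_edge G u v)" by blast
qed

lemma connected_set_contract_edge:
  assumes "connected_set (parcs G) B" "u \<in> B" "v \<in> B" "u \<noteq> v"
  shows "connected_set (parcs (contract_edge G u v)) (B - {v})"
  unfolding connected_set_def
proof (intro conjI allI impI)
  show "B - {v} \<noteq> {}" using assms by auto
next
  fix X assume X: "X \<subset> B - {v} \<and> X \<noteq> {}"
  let ?c = "id(v := u)"
  \<comment> \<open>The cut of \<open>B\<close> that the contraction maps onto the cut \<open>X\<close> keeps \<open>u\<close> and \<open>v\<close> together.\<close>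
  define Y where "Y = (if u \<in> X then insert v X else X)"
  have "Y \<subset> B \<and> Y \<noteq> {}" using X assms by (auto simp: Y_def)
  then obtain x y where xy: "x \<in> Y" "y \<in> B - Y" "(x, y) \<in> parcs G"
    using assms(1) unfolding connected_set_def by blast
  have *: "?c x \<in> X" "?c y \<in> B - {v} - X"
    using xy X assms by (auto simp: Y_def split: if_splits)
  then have "(?c x, ?c y) \<in> parcs (contract_edge G u v)"
    using xy(3) unfolding contract_edge_def by (auto intro!: image_eqI[of _ _ "(x, y)"])
  with * show "\<exists>x\<in>X. \<exists>y\<in>B - {v} - X. (x, y) \<in> parcs (contract_edge G u v)" by blast
qed

text \<open>
  Disjointness of \<open>X\<close> and \<open>Y\<close> matters: an edge between them does not become a loop, so the removal
  of the diagonal does not destroy it.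
\<close>
lemma touches_contract_edge:
  assumes "sym (parcs G)" "X \<inter> Y = {}" "u \<in> X" "v \<in> X" "u \<noteq> v"
  shows "touches (parcs (contract_edge G u v)) (X - {v}) Y \<longleftrightarrow> touches (parcs G) X Y"
proof
  assume "touches (parcs (contract_edge G u v)) (X - {v}) Y"
  then obtain x y where "x \<in> X - {v}" "y \<in> Y" "(x, y) \<in> parcs (contract_edge G u v)"
    unfolding touches_def by blast
  then obtain a b where "(a, b) \<in> parcs G" "(id(v := u)) a \<in> X - {v}" "(id(v := u)) b \<in> Y"
    unfolding contract_edge_def by (auto simp del: fun_upd_apply)
  with assms show "touches (parcs G) X Y"
    unfolding touches_def by (auto split: if_splits)
next
  assume "touches (parcs G) X Y"
  then obtain a b where ab: "(a, b) \<in> parcs G" "a \<in> X" "b \<in> Y" unfolding touches_def by auto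
  have *: "(id(v := u)) a \<in> X - {v}" "(id(v := u)) b = b" "(id(v := u)) a \<noteq> b"
    using ab assms by auto
  then have "((id(v := u)) a, b) \<in> parcs (contract_edge G u v)"
    using ab(1) unfolding contract_edge_def by (auto intro!: image_eqI[of _ _ "(a, b)"])
  with * ab(3) show "touches (parcs (contract_edge G u v)) (X - {v}) Y"
    unfolding touches_def by blast
qed

lemma touches_contract_other:
  assumes "X \<inter> Y = {}" "u \<notin> X" "u \<notin> Y" "v \<notin> X" "v \<notin> Y"
  shows "touches (parcs (contract_edge G u v)) X Y \<longleftrightarrow> touches (parcs G) X Y"
proof
  assume "touches (parcs (contract_edge G u v)) X Y"
  with assms show "touches (parcs G) X Y"
    unfolding touches_def contract_edge_def by (auto split: if_splits)
next
  assume "touches (parcs G) X Y"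
  then obtain a b where ab: "(a, b) \<in> parcs G" "a \<in> X" "b \<in> Y" unfolding touches_def by auto
  with assms have "(a, b) \<in> parcs (contract_edge G u v)"
    unfolding contract_edge_def by (auto intro!: image_eqI[of _ _ "(a, b)"])
  with ab show "touches (parcs (contract_edge G u v)) X Y" unfolding touches_def by blast
qed

lemma is_induced_minor_of_step:
  "induced_minor_step G G' \<Longrightarrow> is_induced_minor_of H G' \<Longrightarrow> is_induced_minor_of H G"
  unfolding is_induced_minor_of_def by (meson converse_rtranclp_into_rtranclp)

lemma singleton_model_is_induced_minor:
  assumes G: "pair_graph G" and H: "pair_graph H" and m: "induced_minor_model H G \<phi>"
    and cover: "pverts G \<subseteq> (\<Union>h\<in>pverts H. \<phi> h)"
    and single: "\<And>h. h \<in> pverts H \<Longrightarrow> \<exists>x. \<phi> h = {x}"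
  shows "is_induced_minor_of H G"
proof -
  obtain e where e: "\<And>h. h \<in> pverts H \<Longrightarrow> \<phi> h = {e h}" using single by metis
  have inj: "inj_on e (pverts H)"
    using m e unfolding induced_minor_model_def inj_on_def by fastforce
  have im: "e ` pverts H = pverts G"
  proof
    show "e ` pverts H \<subseteq> pverts G" using m e by (auto simp: induced_minor_model_def)
    show "pverts G \<subseteq> e ` pverts H" using cover e by auto
  qed
  define f where "f = inv_into (pverts H) e"
  have fe: "f (e h) = h" if "h \<in> pverts H" for h
    using inj that by (simp add: f_def)
  have bij: "bij_betw f (pverts G) (pverts H)"
    using inj im bij_betw_inv_into[of e "pverts H" "pverts G"] by (simp add: f_def bij_betw_def)
  have arcs: "(e h, e h') \<in> parcs G \<longleftrightarrow> (h, h') \<in> parcs H"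
    if "h \<in> pverts H" "h' \<in> pverts H" for h h'
  proof (cases "h = h'")
    case True
    then show ?thesis using G H by (auto simp: pair_graph_iff irrefl_def)
  next
    case False
    then show ?thesis using m e that unfolding induced_minor_model_def touches_def by force
  qed
  have "parcs H = map_prod f f ` parcs G"
  proof (intro set_eqI iffI)
    fix a assume a: "a \<in> parcs H"
    then obtain h h' where hh: "a = (h, h')" "h \<in> pverts H" "h' \<in> pverts H"
      using H by (cases a) (auto simp: pair_graph_iff)
    with a arcs have "(e h, e h') \<in> parcs G" by blast
    moreover have "a = map_prod f f (e h, e h')" using hh fe by simp
    ultimately show "a \<in> map_prod f f ` parcs G" by blast
  next
    fix a assume "a \<in> map_prod f f ` parcs G"
    then obtain x y where xy: "(x, y) \<in> parcs G" "a = (f x, f y)" by auto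
    then have "x \<in> pverts G" "y \<in> pverts G" using G by (auto simp: pair_graph_iff)
    with im obtain h h' where "h \<in> pverts H" "h' \<in> pverts H" "x = e h" "y = e h'" by blast
    with xy fe arcs show "a \<in> parcs H" by simp
  qed
  moreover have "pair_wf_digraph G"
    by unfold_locales (use G in \<open>auto simp: pair_graph_iff\<close>)
  ultimately have "graph_iso G H" using bij by (auto simp: graph_iso_iff)
  then show ?thesis unfolding is_induced_minor_of_def by blast
qed

text \<open>
  Vertices outside the model are deleted, and an edge inside a branch set is contracted; both
  operations leave a model, until every branch set is a single vertex.
\<close>
lemma model_is_induced_minor:
  assumes "pair_graph G" "pair_graph H" "induced_minor_model H G \<phi>"
  shows "is_induced_minor_of H G"
  using assms
proof (induction "card (pverts G)" arbitrary: G \<phi> rule: less_induct)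
  case (less G \<phi>)
  have fin: "finite (pverts G)" and sym: "sym (parcs G)" and irr: "irrefl (parcs G)"
    using less.prems(1) by (auto simp: pair_graph_iff)
  note m = less.prems(3)
  consider v where "v \<in> pverts G" "v \<notin> (\<Union>h\<in>pverts H. \<phi> h)"
    | h where "h \<in> pverts H" "\<nexists>x. \<phi> h = {x}"
    | "pverts G \<subseteq> (\<Union>h\<in>pverts H. \<phi> h)" "\<And>h. h \<in> pverts H \<Longrightarrow> \<exists>x. \<phi> h = {x}"
    by blast
  then show ?case
  proof cases
    case 1
    have t: "touches (parcs (delete_vertex G v)) (\<phi> h) (\<phi> h') \<longleftrightarrow> touches (parcs G) (\<phi> h) (\<phi> h')"
      if "h \<in> pverts H" "h' \<in> pverts H" for h h'
    proof -
      have "v \<notin> \<phi> h" "v \<notin> \<phi> h'" using that 1 by auto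
      then show ?thesis by (auto simp: touches_def delete_vertex_def)
    qed
    have "induced_minor_model H (delete_vertex G v) \<phi>"
      unfolding induced_minor_model_def
    proof (intro conjI ballI impI)
      fix h assume h: "h \<in> pverts H"
      then have "v \<notin> \<phi> h" using 1 by auto
      with h m show "\<phi> h \<subseteq> pverts (delete_vertex G v)"
        by (auto simp: induced_minor_model_def delete_vertex_def)
      show "connected_set (parcs (delete_vertex G v)) (\<phi> h)"
        using h m \<open>v \<notin> \<phi> h\<close> by (simp add: induced_minor_model_def connected_set_delete_vertex)
    next
      fix h h' assume "h \<in> pverts H" "h' \<in> pverts H" "h \<noteq> h'"
      with m t show "\<phi> h \<inter> \<phi> h' = {}"
        "touches (parcs (delete_vertex G v)) (\<phi> h) (\<phi> h') \<longleftrightarrow> (h, h') \<in> parcs H"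
        unfolding induced_minor_model_def by auto
    qed
    moreover have step: "induced_minor_step G (delete_vertex G v)"
      using 1 by (auto intro: induced_minor_step.delete)
    moreover from this have "pair_graph (delete_vertex G v)"
      using less.prems(1) by (rule pair_graph_induced_minor_step)
    moreover have "pverts (delete_vertex G v) = pverts G - {v}" by (simp add: delete_vertex_def)
    then have "card (pverts (delete_vertex G v)) < card (pverts G)"
      using 1 fin by (metis card_Diff1_less)
    ultimately show ?thesis
      by (intro is_induced_minor_of_step[OF step] less.hyps less.prems(2))
  next
    case 2
    have B: "connected_set (parcs G) (\<phi> h)" "\<phi> h \<subseteq> pverts G"
      using 2 m by (auto simp: induced_minor_model_def)
    then obtain x where "x \<in> \<phi> h" unfolding connected_set_def by blast
    moreover from 2(2) have "{x} \<noteq> \<phi> h" by metis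
    ultimately have "{x} \<subset> \<phi> h \<and> {x} \<noteq> {}" by auto
    then have "\<exists>u\<in>{x}. \<exists>v\<in>\<phi> h - {x}. (u, v) \<in> parcs G"
      using B(1) unfolding connected_set_def by metis
    then obtain u v where "u \<in> {x}" "v \<in> \<phi> h - {x}" "(u, v) \<in> parcs G" by auto
    with \<open>x \<in> \<phi> h\<close> have uv: "u \<in> \<phi> h" "v \<in> \<phi> h" "u \<noteq> v" "(u, v) \<in> parcs G" by auto
    let ?G = "contract_edge G u v"
    let ?\<phi> = "\<phi>(h := \<phi> h - {v})"
    have notin: "u \<notin> \<phi> k" "v \<notin> \<phi> k" if "k \<in> pverts H" "k \<noteq> h" for k
      using that 2(1) uv m unfolding induced_minor_model_def by blast+
    have step: "induced_minor_step G ?G" using uv by (auto intro: induced_minor_step.contract)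
    have pg: "pair_graph ?G" using step less.prems(1) by (rule pair_graph_induced_minor_step)
    then have sym': "sym (parcs ?G)" by (simp add: pair_graph_iff)
    have pv: "pverts ?G = pverts G - {v}" by (simp add: contract_edge_def)
    have disj: "\<phi> k \<inter> \<phi> k' = {}" if "k \<in> pverts H" "k' \<in> pverts H" "k \<noteq> k'" for k k'
      using that m unfolding induced_minor_model_def by blast
    have t: "touches (parcs G) (\<phi> k) (\<phi> k') \<longleftrightarrow> (k, k') \<in> parcs H"
      if "k \<in> pverts H" "k' \<in> pverts H" "k \<noteq> k'" for k k'
      using that m unfolding induced_minor_model_def by blast
    have th: "touches (parcs ?G) (\<phi> h - {v}) (\<phi> k) \<longleftrightarrow> touches (parcs G) (\<phi> h) (\<phi> k)"
      if "k \<in> pverts H" "k \<noteq> h" for k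
      using touches_contract_edge[OF sym disj uv(1-3)] that 2(1) by blast
    have "induced_minor_model H ?G ?\<phi>"
      unfolding induced_minor_model_def
    proof (intro conjI ballI impI)
      fix k assume k: "k \<in> pverts H"
      show "?\<phi> k \<subseteq> pverts ?G"
        using k notin[of k] m B pv by (auto simp: induced_minor_model_def)
      show "connected_set (parcs ?G) (?\<phi> k)"
        using k notin[of k] m B uv
        by (auto simp: induced_minor_model_def intro: connected_set_contract_edge
            connected_set_contract_other)
    next
      fix k k' assume k: "k \<in> pverts H" "k' \<in> pverts H" "k \<noteq> k'"
      show "?\<phi> k \<inter> ?\<phi> k' = {}" using disj[OF k] by auto
      consider "k = h" | "k' = h" | "k \<noteq> h" "k' \<noteq> h" by blast
      then show "touches (parcs ?G) (?\<phi> k) (?\<phi> k') \<longleftrightarrow> (k, k') \<in> parcs H"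
      proof cases
        case 1
        then show ?thesis using th[of k'] t[OF k] k by simp
      next
        case k': 2
        have "touches (parcs ?G) (\<phi> k) (\<phi> h - {v}) \<longleftrightarrow> touches (parcs G) (\<phi> k) (\<phi> h)"
          using th[of k] k k' touches_sym[OF sym] touches_sym[OF sym'] by metis
        then show ?thesis using t[OF k] k k' by simp
      next
        case 3
        then show ?thesis using touches_contract_other[OF disj[OF k]] notin k t[OF k] by simp
      qed
    qed
    moreover have "v \<in> pverts G" using uv B by blast
    then have "card (pverts ?G) < card (pverts G)" using fin pv by (metis card_Diff1_less)
    ultimately show ?thesis
      by (intro is_induced_minor_of_step[OF step] less.hyps pg less.prems(2))
  next
    case 3
    then show ?thesis by (rule singleton_model_is_induced_minor[OF less.prems])
  qed
qed

text \<open>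
  Embed \<open>H\<close> into \<open>X\<close> by \<open>e\<close> and keep only the branch sets of the vertices in the image.
\<close>
lemma model_induced_subgraph:
  assumes "is_induced_subgraph_of H X" "induced_minor_model X G \<phi>" "pair_graph X"
  shows "\<exists>\<psi>. induced_minor_model H G \<psi>"
proof -
  obtain X' where X': "induced_subgraph (with_proj X') (with_proj X)" "graph_iso X' H"
    using assms(1) unfolding is_induced_subgraph_of_def by auto
  have V: "pverts X' \<subseteq> pverts X"
    and A: "parcs X' = {(x, y) \<in> parcs X. x \<in> pverts X' \<and> y \<in> pverts X'}"
    using X'(1) by (auto simp: induced_subgraph_def subgraph_def)
  have "pair_wf_digraph X'" by unfold_locales (use A in auto)
  then obtain f where f: "bij_betw f (pverts X') (pverts H)" "parcs H = map_prod f f ` parcs X'"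
    using X'(2) by (auto simp: graph_iso_iff)
  define e where "e = inv_into (pverts X') f"
  have e: "e h \<in> pverts X'" "f (e h) = h" if "h \<in> pverts H" for h
    using f(1) that bij_betw_inv_into_right[of f] bij_betwE[OF bij_betw_inv_into[OF f(1)]]
    by (auto simp: e_def)
  have fi: "e (f x) = x" if "x \<in> pverts X'" for x
    using f(1) that bij_betw_inv_into_left[of f] by (auto simp: e_def)
  have arc: "(h, h') \<in> parcs H \<longleftrightarrow> (e h, e h') \<in> parcs X" if "h \<in> pverts H" "h' \<in> pverts H" for h h'
  proof
    assume "(h, h') \<in> parcs H"
    then obtain x y where "(x, y) \<in> parcs X'" "h = f x" "h' = f y" using f(2) by auto
    then show "(e h, e h') \<in> parcs X" using fi A by auto
  next
    assume "(e h, e h') \<in> parcs X"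
    then have "(e h, e h') \<in> parcs X'" using A e that by auto
    then have "map_prod f f (e h, e h') \<in> parcs H" using f(2) by blast
    then show "(h, h') \<in> parcs H" using e that by simp
  qed
  have "e h \<noteq> e h'" if "h \<in> pverts H" "h' \<in> pverts H" "h \<noteq> h'" for h h'
    using e that by metis
  then have "induced_minor_model H G (\<phi> \<circ> e)"
    using assms(2) e V arc unfolding induced_minor_model_def by (auto simp: subset_iff)
  then show ?thesis by (rule exI[of _ "\<phi> \<circ> e"])
qed


section \<open>Models of $K_{2,r}$ and of the cone over it\<close>

text \<open>
  A model of $K_{2,r}$ inside \<open>W\<close> in which only the branch set \<open>A\<close> of one vertex of the part of
  size two may have more than one element; models of this kind are all that the degeneracy
  argument produces.
\<close>
definition K2r_pattern ::
    "('a \<times> 'a) set \<Rightarrow> 'a set \<Rightarrow> nat \<Rightarrow> 'a set \<Rightarrow> 'a \<Rightarrow> 'a set \<Rightarrow> bool" where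
  "K2r_pattern E W r A b S \<longleftrightarrow>
     A \<subseteq> W \<and> b \<in> W \<and> S \<subseteq> W \<and> finite S \<and> card S = r \<and> connected_set E A \<and>
     b \<notin> A \<and> b \<notin> S \<and> A \<inter> S = {} \<and> \<not> touches E A {b} \<and>
     (\<forall>s\<in>S. touches E A {s} \<and> (b, s) \<in> E) \<and> (\<forall>s\<in>S. \<forall>t\<in>S. (s, t) \<notin> E)"

text \<open>
  The branch set \<open>P\<close> of the apex is required to have a neighbour of each vertex of a set around the
  model of $K_{2,r}$, not only of each branch set, since this is what a distance layer offers.
\<close>
definition cone_pattern :: "('a \<times> 'a) set \<Rightarrow> 'a set \<Rightarrow> nat \<Rightarrow> bool" where
  "cone_pattern E V r \<longleftrightarrow> (\<exists>P W A b S. P \<subseteq> V \<and> W \<subseteq> V \<and> P \<inter> W = {} \<and> connected_set E P \<and>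
     (\<forall>y\<in>W. touches E P {y}) \<and> K2r_pattern E W r A b S)"

lemma K2r_pattern_mono: "K2r_pattern E U r A b S \<Longrightarrow> U \<subseteq> W \<Longrightarrow> K2r_pattern E W r A b S"
  unfolding K2r_pattern_def by blast

lemma cone_pattern_mono: "cone_pattern E U r \<Longrightarrow> U \<subseteq> V \<Longrightarrow> cone_pattern E V r"
  unfolding cone_pattern_def by (elim ex_forward) auto

lemma cone_pattern_branch_sets:
  assumes "cone_pattern E V r" "sym E"
  obtains P A b s where
    "P \<subseteq> V" "A \<subseteq> V" "b \<in> V" "\<And>i. i < r \<Longrightarrow> s i \<in> V"
    "connected_set E P" "connected_set E A"
    "P \<inter> A = {}" "b \<notin> P" "b \<notin> A" "\<And>i. i < r \<Longrightarrow> s i \<notin> P" "\<And>i. i < r \<Longrightarrow> s i \<notin> A"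
    "\<And>i. i < r \<Longrightarrow> s i \<noteq> b" "\<And>i j. i < r \<Longrightarrow> j < r \<Longrightarrow> s i = s j \<longleftrightarrow> i = j"
    "touches E P A" "touches E P {b}" "\<And>i. i < r \<Longrightarrow> touches E P {s i}"
    "\<not> touches E A {b}" "\<And>i. i < r \<Longrightarrow> touches E A {s i}"
    "\<And>i. i < r \<Longrightarrow> touches E {b} {s i}" "\<And>i j. i < r \<Longrightarrow> j < r \<Longrightarrow> \<not> touches E {s i} {s j}"
proof -
  obtain P W A b S where p: "P \<subseteq> V" "W \<subseteq> V" "P \<inter> W = {}" "connected_set E P"
    "\<forall>y\<in>W. touches E P {y}" and k: "K2r_pattern E W r A b S"
    using assms(1) unfolding cone_pattern_def by blast
  obtain s where s: "bij_betw s {..<r} S"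
    using k ex_bij_betw_nat_finite[of S] unfolding K2r_pattern_def
    by (auto simp: atLeast0LessThan)
  have s_inj: "s i = s j \<longleftrightarrow> i = j" if "i < r" "j < r" for i j
    using s that by (auto simp: bij_betw_def inj_on_def)
  have k': "A \<subseteq> W" "b \<in> W" "S \<subseteq> W" "connected_set E A" "b \<notin> A" "b \<notin> S" "A \<inter> S = {}"
    "\<not> touches E A {b}" "\<And>t. t \<in> S \<Longrightarrow> touches E A {t}" "\<And>t. t \<in> S \<Longrightarrow> touches E {b} {t}"
    "\<And>t u. t \<in> S \<Longrightarrow> u \<in> S \<Longrightarrow> \<not> touches E {t} {u}"
    using k by (simp_all add: K2r_pattern_def touches_def)
  have sS: "s i \<in> S" if "i < r" for i using s that by (auto simp: bij_betw_def)
  have sW: "s i \<in> W" "s i \<notin> A" "s i \<noteq> b" if "i < r" for i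
    using sS[OF that] k'(3,6,7) by auto
  have PW: "x \<notin> P" "x \<in> V" "touches E P {x}" if "x \<in> W" for x
    using that p by auto
  obtain a where a: "a \<in> A" using k'(4) by (auto simp: connected_set_def)
  with k'(1) have "touches E P {a}" by (intro PW) auto
  with a have PA: "touches E P A" by (auto simp: touches_def)
  have "A \<subseteq> V" "P \<inter> A = {}" using p k'(1) by auto
  then show thesis
    by (intro that[of P A b s] p k' PA sS s_inj sW PW)
qed

text \<open>
  Each branch set is a union of branch sets of the cone over $K_{2,q+3}$. The union of \<open>b\<close> and one
  of the \<open>s i\<close> is adjacent to \<open>A\<close>, which supplies the edge that \<open>K2q_plus\<close> and \<open>K5_minus\<close> have
  in addition to the edges of a (cone over a) complete bipartite graph. The number \<open>q + 3\<close> leaves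
  an \<open>s i\<close> for this purpose beside the \<open>q\<close> vertices of \<open>K2q_plus\<close> and beside the two nonadjacent
  vertices of \<open>K5_minus\<close>.
\<close>
lemma cone_pattern_models:
  assumes cone: "cone_pattern (parcs G) (pverts G) (q + 3)" and G: "pair_graph G"
    and X: "X \<in> {W4, K5_minus, K2q q, K2q_plus q}"
  shows "\<exists>\<phi>. induced_minor_model X G \<phi>"
proof (rule cone_pattern_branch_sets[OF cone], goal_cases)
  let ?E = "parcs G"
  show sym: "sym ?E" using G by (simp add: pair_graph_iff)
  case (2 P A b s)
  note b = 2
  have b': "touches ?E A P" "touches ?E {b} P" "\<And>i. i < q + 3 \<Longrightarrow> touches ?E {s i} P"
    "\<not> touches ?E {b} A" "\<And>i. i < q + 3 \<Longrightarrow> touches ?E {s i} A"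
    "\<And>i. i < q + 3 \<Longrightarrow> touches ?E {s i} {b}" "A \<inter> P = {}" "\<And>i. i < q + 3 \<Longrightarrow> b \<noteq> s i"
  proof -
    have swap: "touches ?E Y X" if "touches ?E X Y" for X Y
      using that touches_sym[OF sym] by blast
    show "touches ?E A P" "touches ?E {b} P"
      by (rule swap[OF b(14)], rule swap[OF b(15)])
    show "touches ?E {s i} P" "touches ?E {s i} A" "touches ?E {s i} {b}" if "i < q + 3" for i
      by (rule swap[OF b(16)[OF that]], rule swap[OF b(18)[OF that]], rule swap[OF b(19)[OF that]])
    show "\<not> touches ?E {b} A" using b(17) swap by blast
    show "A \<inter> P = {}" using b(7) by blast
    show "b \<noteq> s i" if "i < q + 3" for i using b(12)[OF that] by simp
  qed
  have pair: "connected_set ?E {b, s i}" if "i < q + 3" for i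
    using connected_set_Un_neighbors[OF sym connected_set_singleton, of "{s i}" b] b(19)[OF that]
    by (simp add: insert_commute)
  have W4: "induced_minor_model W4 G (\<lambda>i. [A, {s 0}, {b}, {s 1}, P] ! i)"
    unfolding induced_minor_model_def W4_def symcl_def
    by (simp add: b b' connected_set_singleton)
  have "{..<5::nat} = {0, 1, 2, 3, 4}" by auto
  then have K5_minus: "induced_minor_model K5_minus G (\<lambda>i. [{s 0}, {s 1}, A, {b, s 2}, P] ! i)"
    unfolding induced_minor_model_def K5_minus_def
    by (simp add: b b' pair connected_set_singleton touches_insert_left[of _ b "{s 2}"]
        touches_insert_right[of _ _ b "{s 2}"])
  have K2q: "induced_minor_model (K2q q) G
      (\<lambda>i. if i = 0 then A else if i = 1 then {b} else {s (i - 2)})"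
    unfolding induced_minor_model_def K2q_def symcl_def
    by (auto simp: b b' connected_set_singleton)
  have K2q_plus: "induced_minor_model (K2q_plus q) G
      (\<lambda>i. if i = 0 then A else if i = 1 then {b, s q} else {s (i - 2)})"
    unfolding induced_minor_model_def K2q_plus_def K2q_def symcl_def
    by (auto simp: b b' pair connected_set_singleton touches_insert_left[of _ b "{s q}"]
        touches_insert_right[of _ _ b "{s q}"])
  show ?case using X W4 K5_minus K2q K2q_plus by auto
qed


section \<open>Degeneracy of graphs without $K_{2,r}$\<close>

definition clique_in :: "('a \<times> 'a) set \<Rightarrow> 'a set \<Rightarrow> bool" where
  "clique_in E K \<longleftrightarrow> (\<forall>u\<in>K. \<forall>v\<in>K. u \<noteq> v \<longrightarrow> (u, v) \<in> E)"

lemma ramsey_clique_or_stable: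
  "\<exists>R. \<forall>E (V :: 'a set). sym E \<longrightarrow> irrefl E \<longrightarrow> finite V \<longrightarrow> R \<le> card V \<longrightarrow>
     (\<exists>K\<subseteq>V. card K = m \<and> clique_in E K \<or>
            card K = n \<and> (\<forall>x\<in>K. \<forall>y\<in>K. (x, y) \<notin> E))"
proof -
  obtain R where R: "\<And>(V :: 'a set) F. finite V \<Longrightarrow> R \<le> card V \<Longrightarrow>
      \<exists>K\<subseteq>V. card K = m \<and> Ramsey.clique K F \<or> card K = n \<and> Ramsey.indep K F"
    using ramsey2[of m n, where 'a = 'a] by auto
  have "\<exists>K\<subseteq>V. card K = m \<and> clique_in E K \<or> card K = n \<and> (\<forall>x\<in>K. \<forall>y\<in>K. (x, y) \<notin> E)"
    if "sym E" "irrefl E" "finite V" "R \<le> card V" for E and V :: "'a set"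
  proof -
    let ?F = "{{x, y} | x y. (x, y) \<in> E}"
    have F: "{x, y} \<in> ?F \<longleftrightarrow> (x, y) \<in> E" for x y
      using \<open>sym E\<close> by (auto simp: doubleton_eq_iff sym_def)
    have "Ramsey.clique K ?F \<longleftrightarrow> clique_in E K"
      "Ramsey.indep K ?F \<longleftrightarrow> (\<forall>x\<in>K. \<forall>y\<in>K. (x, y) \<notin> E)" for K
      unfolding Ramsey.clique_def Ramsey.indep_def clique_in_def F
      using \<open>irrefl E\<close> by (auto simp: irrefl_def) metis
    then show ?thesis using R[OF that(3,4), of ?F] by simp
  qed
  then show ?thesis by blast
qed

definition K2r_clique_free :: "('a \<times> 'a) set \<Rightarrow> 'a set \<Rightarrow> nat \<Rightarrow> nat \<Rightarrow> bool" where
  "K2r_clique_free E W r w \<longleftrightarrow> sym E \<and> irrefl E \<and> finite W \<and>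
     (\<forall>A b S. \<not> K2r_pattern E W r A b S) \<and> (\<forall>K\<subseteq>W. clique_in E K \<longrightarrow> card K \<le> w)"

text \<open>
  The bound is found by induction on the clique number \<open>w\<close>.
  The argument generalizes the proof that a chordal graph has a simplicial vertex. Let \<open>A\<close> be a largest
  connected set whose closed neighbourhood is not everything, let \<open>N\<close> be its neighbourhood and
  \<open>D\<close> the nonempty rest. Moving a vertex of \<open>N\<close> to \<open>A\<close> must make every vertex of \<open>D\<close> a neighbour,
  so \<open>N\<close> is complete to \<open>D\<close>. A stable set in \<open>N\<close> forms a $K_{2,r}$ with \<open>A\<close> and a vertex of \<open>D\<close>;
  hence \<open>N\<close> has bounded size by Ramsey's theorem. If \<open>N\<close> is nonempty, then the clique number of
  \<open>D\<close> is smaller, and a vertex of small degree in \<open>D\<close> has small degree in total. If \<open>N\<close> is empty,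
  then \<open>D\<close> is a smaller graph in which all degrees are as before.
\<close>
lemma K2r_free_small_degree:
  "\<exists>g. \<forall>E (W :: 'a set). K2r_clique_free E W r w \<longrightarrow> W \<noteq> {} \<longrightarrow>
     (\<exists>d\<in>W. card {y\<in>W. (d, y) \<in> E} \<le> g)"
proof (induction w)
  case 0
  have "W = {}" if "K2r_clique_free E W r 0" for E and W :: "'a set"
  proof (rule ccontr)
    assume "W \<noteq> {}"
    then obtain x where "x \<in> W" by blast
    moreover have "clique_in E {x}" by (simp add: clique_in_def)
    ultimately have "card {x} \<le> 0"
      using that unfolding K2r_clique_free_def by (metis bot.extremum insert_subset)
    then show False by simp
  qed
  then show ?case by auto
next
  case (Suc w)
  from Suc.IH obtain g where g: "\<forall>E (W :: 'a set). K2r_clique_free E W r w \<longrightarrow> W \<noteq> {} \<longrightarrow>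
      (\<exists>d\<in>W. card {y\<in>W. (d, y) \<in> E} \<le> g)"
    by (rule exE) (rule that)
  from ramsey_clique_or_stable obtain R where
    R: "\<forall>E (V :: 'a set). sym E \<longrightarrow> irrefl E \<longrightarrow> finite V \<longrightarrow> R \<le> card V \<longrightarrow>
      (\<exists>K\<subseteq>V. card K = Suc (Suc w) \<and> clique_in E K \<or>
             card K = r \<and> (\<forall>x\<in>K. \<forall>y\<in>K. (x, y) \<notin> E))"
    by (rule exE) (rule that)
  have "\<exists>d\<in>W. card {y\<in>W. (d, y) \<in> E} \<le> g + R + Suc w"
    if "finite W" "K2r_clique_free E W r (Suc w)" "W \<noteq> {}" for E and W :: "'a set"
    using that
  proof (induction W rule: finite_psubset_induct)
    case (psubset W)
    have E: "sym E" "irrefl E" and om: "\<And>K. K \<subseteq> W \<Longrightarrow> clique_in E K \<Longrightarrow> card K \<le> Suc w"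
      and nopat: "\<And>A b S. \<not> K2r_pattern E W r A b S"
      using psubset.prems(1) by (auto simp: K2r_clique_free_def)
    have fin: "finite X" if "X \<subseteq> W" for X using that \<open>finite W\<close> by (rule finite_subset)
    define rest where "rest A = {y \<in> W - A. \<not> touches E A {y}}" for A
    show ?case
    proof (cases "clique_in E W")
      case True
      then have "card W \<le> Suc w" by (intro om) auto
      moreover obtain d where "d \<in> W" using psubset.prems(2) by blast
      moreover have "card {y\<in>W. (d, y) \<in> E} \<le> card W" by (intro card_mono fin) auto
      ultimately show ?thesis by (intro bexI[of _ d]) auto
    next
      case False
      then obtain x z where "x \<in> W" "z \<in> rest {x}"
        unfolding clique_in_def rest_def touches_def by auto
      define good where "good A \<longleftrightarrow> A \<subseteq> W \<and> connected_set E A \<and> rest A \<noteq> {}" for A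
      have "good {x}" using \<open>x \<in> W\<close> \<open>z \<in> rest {x}\<close> connected_set_singleton by (auto simp: good_def)
      moreover have "card A \<le> card W" if "good A" for A
        using that \<open>finite W\<close> by (auto simp: good_def intro: card_mono)
      ultimately have "\<exists>A. good A \<and> (\<forall>B. good B \<longrightarrow> card B \<le> card A)"
        by (intro ex_has_greatest_nat[of good "{x}" card "Suc (card W)"]) (auto simp: less_Suc_eq_le)
      then obtain A where A: "good A" and maxA: "\<And>B. good B \<Longrightarrow> card B \<le> card A" by auto
      define D where "D = rest A"
      define N where "N = {y \<in> W - A. touches E A {y}}"
      have AW: "A \<subseteq> W" "connected_set E A" and D: "D \<noteq> {}" "D \<subseteq> W" "D \<inter> A = {}"
        using A by (auto simp: good_def D_def rest_def)
      \<comment> \<open>Otherwise \<open>s\<close> could be moved to \<open>A\<close> while \<open>d\<close> stays outside the closed neighbourhood.\<close>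
      have ND: "(s, d) \<in> E" if "s \<in> N" "d \<in> D" for s d
      proof (rule ccontr)
        assume nE: "(s, d) \<notin> E"
        have "connected_set E (A \<union> {s})"
          using that(1) by (intro connected_set_Un_neighbors E AW) (auto simp: N_def)
        moreover have "d \<in> rest (A \<union> {s})"
          using that nE by (auto simp: D_def N_def rest_def touches_def)
        ultimately have "good (A \<union> {s})" using AW that(1) by (auto simp: good_def N_def)
        then have "card (A \<union> {s}) \<le> card A" by (rule maxA)
        moreover have "s \<notin> A" using that(1) by (simp add: N_def)
        ultimately show False using fin[OF AW(1)] by simp
      qed
      have "A \<noteq> {}" using AW(2) by (simp add: connected_set_def)
      then have DW: "D \<subset> W" using D AW by blast
      have nopatD: "\<not> K2r_pattern E D r A b S" for A b S
        using nopat K2r_pattern_mono[OF _ D(2)] by blast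
      have nb: "{y\<in>W. (d, y) \<in> E} \<subseteq> {y\<in>D. (d, y) \<in> E} \<union> N" if "d \<in> D" for d
        using that E(1) unfolding D_def N_def rest_def touches_def sym_def by blast
      show ?thesis
      proof (cases "N = {}")
        case True
        have "K2r_clique_free E D r (Suc w)"
          using E nopatD om D(2) fin[OF D(2)] by (auto simp: K2r_clique_free_def)
        from psubset.IH[OF DW this D(1)] obtain d
          where d: "d \<in> D" "card {y\<in>D. (d, y) \<in> E} \<le> g + R + Suc w" by blast
        have "card {y\<in>W. (d, y) \<in> E} \<le> card {y\<in>D. (d, y) \<in> E}"
          using nb[OF d(1)] True fin[OF D(2)] by (intro card_mono) auto
        with d D(2) show ?thesis by (intro bexI[of _ d]) auto
      next
        case False
        then obtain s where s: "s \<in> N" by blast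
        have "card K \<le> w" if K: "K \<subseteq> D" "clique_in E K" for K
        proof -
          have "clique_in E (insert s K)"
            using K ND[OF s] E(1) unfolding clique_in_def sym_def by blast
          moreover have "insert s K \<subseteq> W" using s K D by (auto simp: N_def)
          ultimately have "card (insert s K) \<le> Suc w" by (intro om)
          moreover have "s \<notin> K" using s K by (auto simp: N_def D_def rest_def)
          moreover have "finite K" using K D fin by blast
          ultimately show ?thesis by simp
        qed
        then have "K2r_clique_free E D r w"
          using E nopatD fin[OF D(2)] by (auto simp: K2r_clique_free_def)
        with g D(1) obtain d where d: "d \<in> D" "card {y\<in>D. (d, y) \<in> E} \<le> g" by blast
        have "card N < R"
        proof (rule ccontr)
          assume "\<not> card N < R"
          moreover have NW: "N \<subseteq> W" by (auto simp: N_def)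
          ultimately obtain K where K: "K \<subseteq> N" "card K = Suc (Suc w) \<and> clique_in E K \<or>
              card K = r \<and> (\<forall>x\<in>K. \<forall>y\<in>K. (x, y) \<notin> E)"
            using R[rule_format, OF E fin[OF NW]] by (auto simp: not_less)
          have "\<not> (card K = Suc (Suc w) \<and> clique_in E K)"
            using om[OF subset_trans[OF K(1) NW]] by auto
          with K have K': "card K = r" "\<forall>x\<in>K. \<forall>y\<in>K. (x, y) \<notin> E" by auto
          have "K2r_pattern E W r A d K"
            unfolding K2r_pattern_def
            using AW d(1) D K' K(1) NW fin[OF subset_trans[OF K(1) NW]] ND E(1)
            by (auto simp: N_def D_def rest_def sym_def)
          then show False using nopat by blast
        qed
        moreover have "card {y\<in>W. (d, y) \<in> E} \<le> card ({y\<in>D. (d, y) \<in> E} \<union> N)"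
          using nb[OF d(1)] fin[OF D(2)] fin[of N] by (intro card_mono) (auto simp: N_def)
        moreover have "\<dots> \<le> card {y\<in>D. (d, y) \<in> E} + card N" by (rule card_Un_le)
        ultimately show ?thesis using d D(2) by (intro bexI[of _ d]) auto
      qed
    qed
  qed
  then have "\<forall>E (W :: 'a set). K2r_clique_free E W r (Suc w) \<longrightarrow> W \<noteq> {} \<longrightarrow>
      (\<exists>d\<in>W. card {y\<in>W. (d, y) \<in> E} \<le> g + R + Suc w)"
    by (simp add: K2r_clique_free_def)
  then show ?case by (rule exI)
qed


section \<open>Colouring\<close>

definition colorable :: "('a \<times> 'a) set \<Rightarrow> 'a set \<Rightarrow> nat \<Rightarrow> bool" where
  "colorable E W k \<longleftrightarrow>
     (\<exists>c. c ` W \<subseteq> {..<k} \<and> (\<forall>x\<in>W. \<forall>y\<in>W. (x, y) \<in> E \<longrightarrow> c x \<noteq> c y))"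

text \<open>
  Greedy colouring: among \<open>g + 1\<close> colours, one is free at a vertex of degree at most \<open>g\<close>.
\<close>
lemma degenerate_colorable:
  assumes "finite W" "sym E" "irrefl E"
    "\<And>U. U \<subseteq> W \<Longrightarrow> U \<noteq> {} \<Longrightarrow> \<exists>d\<in>U. card {y\<in>U. (d, y) \<in> E} \<le> g"
  shows "colorable E W (Suc g)"
  using assms
proof (induction W rule: finite_psubset_induct)
  case (psubset W)
  show ?case
  proof (cases "W = {}")
    case True
    then show ?thesis by (simp add: colorable_def)
  next
    case False
    then obtain d where d: "d \<in> W" "card {y\<in>W. (d, y) \<in> E} \<le> g" using psubset.prems(3) by blast
    let ?N = "{y\<in>W. (d, y) \<in> E}"
    have "colorable E (W - {d}) (Suc g)"
      using d psubset.prems by (intro psubset.IH) auto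
    then obtain c where c: "c ` (W - {d}) \<subseteq> {..<Suc g}"
      "\<forall>x\<in>W - {d}. \<forall>y\<in>W - {d}. (x, y) \<in> E \<longrightarrow> c x \<noteq> c y" unfolding colorable_def by blast
    have "card (c ` ?N) < card {..<Suc g}"
      using d(2) card_image_le[of ?N c] \<open>finite W\<close> by simp
    moreover have "finite (c ` ?N)" using \<open>finite W\<close> by simp
    ultimately have "\<not> {..<Suc g} \<subseteq> c ` ?N" using card_mono not_less by blast
    then obtain a where a: "a < Suc g" "a \<notin> c ` ?N" by auto
    have "(d, d) \<notin> E" using \<open>irrefl E\<close> by (simp add: irrefl_def)
    then have "\<forall>x\<in>W. \<forall>y\<in>W. (x, y) \<in> E \<longrightarrow> (c(d := a)) x \<noteq> (c(d := a)) y"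
      using c(2) a(2) \<open>sym E\<close> by (auto simp: sym_def)
    moreover have "(c(d := a)) ` W \<subseteq> {..<Suc g}" using c(1) a(1) by auto
    ultimately show ?thesis unfolding colorable_def by blast
  qed
qed

primrec ball :: "('a \<times> 'a) set \<Rightarrow> 'a set \<Rightarrow> 'a \<Rightarrow> nat \<Rightarrow> 'a set" where
  "ball E W v 0 = {v}"
| "ball E W v (Suc n) = ball E W v n \<union> {y\<in>W. touches E (ball E W v n) {y}}"

lemma ball_subset: "v \<in> W \<Longrightarrow> ball E W v n \<subseteq> W"
  by (induction n) auto

lemma connected_set_ball: "sym E \<Longrightarrow> connected_set E (ball E W v n)"
proof (induction n)
  case 0
  show ?case by (simp add: connected_set_singleton)
next
  case (Suc n)
  then have "connected_set E (ball E W v n \<union> {y\<in>W. touches E (ball E W v n) {y}})"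
    by (intro connected_set_Un_neighbors) auto
  then show ?case by simp
qed

text \<open>
  The set \<open>R\<close> of vertices that are reachable from a root \<open>v\<close> has no edges to the rest, which can be
  coloured by induction. In \<open>R\<close>, the ball of the vertices closer to \<open>v\<close> than a given layer serves as
  the apex of a cone over this layer, so each layer but the single vertex \<open>v\<close> is free of $K_{2,r}$
  by this argument and can be coloured with \<open>k\<close> colours. Two disjoint palettes, chosen by the
  parity of the layer, keep consecutive layers apart.
\<close>
lemma cone_free_colorable:
  assumes "finite V" "sym E" "\<not> cone_pattern E V r" "k \<ge> 1"
    and layer: "\<And>W. W \<subseteq> V \<Longrightarrow> \<forall>A b S. \<not> K2r_pattern E W r A b S \<Longrightarrow> colorable E W k"
    and irr: "irrefl E"
  shows "colorable E V (2 * k)"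
  using assms(1,3) layer
proof (induction V rule: finite_psubset_induct)
  case (psubset V)
  show ?case
  proof (cases "V = {}")
    case True
    then show ?thesis by (simp add: colorable_def)
  next
    case False
    then obtain v where v: "v \<in> V" by blast
    let ?B = "ball E V v"
    define R where "R = (\<Union>n. ?B n)"
    define dist where "dist x = (LEAST n. x \<in> ?B n)" for x
    define layer where "layer n = {x\<in>R. dist x = n}" for n
    have RV: "R \<subseteq> V" using ball_subset[OF v] by (auto simp: R_def)
    have "?B 0 \<subseteq> R" unfolding R_def by blast
    then have "v \<in> R" by simp
    have dB: "x \<in> ?B (dist x)" if "x \<in> R" for x
      using that LeastI_ex[of "\<lambda>n. x \<in> ?B n"] by (auto simp: R_def dist_def)
    have d_le: "dist x \<le> n" if "x \<in> ?B n" for x n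
      using that by (simp add: dist_def Least_le)
    have closed: "y \<in> R \<and> dist y \<le> Suc (dist x)" if "x \<in> R" "y \<in> V" "(x, y) \<in> E" for x y
    proof -
      have "touches E (?B (dist x)) {y}" using dB[OF that(1)] that by (auto simp: touches_def)
      then have "y \<in> ?B (Suc (dist x))" using that by simp
      then show ?thesis using d_le unfolding R_def by blast
    qed
    have "colorable E (layer n) k" for n
    proof (cases n)
      case 0
      have "layer 0 \<subseteq> {v}" using dB by (force simp: layer_def)
      then have "\<forall>x\<in>layer 0. \<forall>y\<in>layer 0. (x, y) \<notin> E" using irr by (auto simp: irrefl_def)
      then show ?thesis
        using 0 \<open>k \<ge> 1\<close> unfolding colorable_def by (intro exI[of _ "\<lambda>_. 0"]) auto
    next
      case (Suc m)
      have LV: "layer n \<subseteq> V" using RV by (auto simp: layer_def)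
      have disj: "?B m \<inter> layer n = {}" using d_le Suc by (fastforce simp: layer_def)
      have adj: "touches E (?B m) {y}" if "y \<in> layer n" for y
        using that disj dB[of y] Suc by (auto simp: layer_def)
      have "\<not> K2r_pattern E (layer n) r A b S" for A b S
      proof
        assume "K2r_pattern E (layer n) r A b S"
        then have "cone_pattern E V r"
          unfolding cone_pattern_def
          using ball_subset[OF v] connected_set_ball[OF \<open>sym E\<close>] LV disj adj
          by (intro exI[of _ "?B m"] exI[of _ "layer n"] exI[of _ A] exI[of _ b] exI[of _ S]) simp
        with psubset.prems(1) show False ..
      qed
      then show ?thesis using psubset.prems(2)[OF LV] by simp
    qed
    then have "\<forall>n. \<exists>c. c ` layer n \<subseteq> {..<k} \<and>
        (\<forall>x\<in>layer n. \<forall>y\<in>layer n. (x, y) \<in> E \<longrightarrow> c x \<noteq> c y)"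
      by (simp add: colorable_def)
    from choice[OF this] obtain c where c0: "\<forall>n. c n ` layer n \<subseteq> {..<k} \<and>
        (\<forall>x\<in>layer n. \<forall>y\<in>layer n. (x, y) \<in> E \<longrightarrow> c n x \<noteq> c n y)"
      by (rule exE) (rule that)
    then have c: "\<And>n. c n ` layer n \<subseteq> {..<k}"
      "\<And>n x y. x \<in> layer n \<Longrightarrow> y \<in> layer n \<Longrightarrow> (x, y) \<in> E \<Longrightarrow> c n x \<noteq> c n y"
      by simp_all
    have "V - R \<subset> V" using \<open>v \<in> R\<close> v by blast
    moreover have "\<not> cone_pattern E (V - R) r"
      using psubset.prems(1) cone_pattern_mono by (metis Diff_subset)
    ultimately have "colorable E (V - R) (2 * k)"
      using psubset.prems(2) by (intro psubset.IH) auto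
    then obtain e where e: "e ` (V - R) \<subseteq> {..<2 * k}"
      "\<forall>x\<in>V - R. \<forall>y\<in>V - R. (x, y) \<in> E \<longrightarrow> e x \<noteq> e y" unfolding colorable_def by blast
    define col where
      "col x = (if x \<in> R then c (dist x) x + k * (dist x mod 2) else e x)" for x
    have ck: "c (dist x) x < k" if "x \<in> R" for x
      using that c(1)[of "dist x"] by (auto simp: layer_def)
    have "col x < 2 * k" if "x \<in> V" for x
    proof (cases "x \<in> R")
      case True
      have "dist x mod 2 = 0 \<or> dist x mod 2 = 1" by auto
      then show ?thesis using ck[OF True] True by (auto simp: col_def simp del: One_nat_def)
    next
      case False
      then show ?thesis using that e(1) by (auto simp: col_def)
    qed
    moreover have "col x \<noteq> col y" if xy: "x \<in> V" "y \<in> V" "(x, y) \<in> E" for x y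
    proof (cases "x \<in> R")
      case False
      then have "y \<notin> R" using closed[of y x] xy \<open>sym E\<close> by (auto simp: sym_def)
      then show ?thesis using False e(2) xy by (simp add: col_def)
    next
      case True
      then have y: "y \<in> R" "dist y \<le> Suc (dist x)" using closed xy by blast+
      then have "dist x \<le> Suc (dist y)" using closed[of y x] xy \<open>sym E\<close> by (auto simp: sym_def)
      with y(2) have "dist x = dist y \<or> dist x mod 2 \<noteq> dist y mod 2" by presburger
      then consider "dist x = dist y" | "dist x mod 2 \<noteq> dist y mod 2" by auto
      then show ?thesis
      proof cases
        case 1
        then show ?thesis using c(2)[of x "dist x" y] True y xy by (simp add: col_def layer_def)
      next
        case 2
        then have "dist x mod 2 = 0 \<and> dist y mod 2 = 1 \<or> dist x mod 2 = 1 \<and> dist y mod 2 = 0"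
          by auto
        then show ?thesis using ck[OF True] ck[OF y(1)] True y(1) by (auto simp: col_def)
      qed
    qed
    ultimately show ?thesis unfolding colorable_def by (intro exI[of _ col]) auto
  qed
qed

lemma cone_free_chi_bounded:
  assumes "\<And>G. G \<in> \<G> \<Longrightarrow> pair_graph G"
    and "\<And>G. G \<in> \<G> \<Longrightarrow> \<not> cone_pattern (parcs G) (pverts G) r"
  shows "chi_bounded (\<G> :: 'a pair_pre_digraph set)"
proof -
  have "\<exists>g. \<forall>w E (W :: 'a set). K2r_clique_free E W r w \<longrightarrow> W \<noteq> {} \<longrightarrow>
      (\<exists>d\<in>W. card {y\<in>W. (d, y) \<in> E} \<le> g w)"
    by (rule choice, rule allI, rule K2r_free_small_degree)
  then obtain g where g: "\<forall>w E (W :: 'a set). K2r_clique_free E W r w \<longrightarrow> W \<noteq> {} \<longrightarrow>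
      (\<exists>d\<in>W. card {y\<in>W. (d, y) \<in> E} \<le> g w)"
    by (rule exE) (rule that)
  have "chromatic_number G' \<le> 2 * Suc (g (clique_number G'))"
    if "G \<in> \<G>" and ind: "induced_subgraph (with_proj G') (with_proj G)" for G G'
  proof -
    have V: "pverts G' \<subseteq> pverts G"
      and A: "parcs G' = {(x, y) \<in> parcs G. x \<in> pverts G' \<and> y \<in> pverts G'}"
      using ind by (auto simp: induced_subgraph_def subgraph_def)
    have E: "sym (parcs G)" "irrefl (parcs G)" and fin: "finite (pverts G')"
      using assms(1)[OF \<open>G \<in> \<G>\<close>] V by (auto simp: pair_graph_iff intro: finite_subset)
    have omega: "card K \<le> clique_number G'" if "K \<subseteq> pverts G'" "clique_in (parcs G) K" for K
    proof -
      have "Defs.clique G' K" using that A by (auto simp: Defs.clique_def clique_in_def)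
      moreover have "finite {card K | K. Defs.clique G' K}"
        using fin by (auto simp: Defs.clique_def intro: finite_subset[of _ "card ` Pow (pverts G')"])
      ultimately show ?thesis unfolding clique_number_def by (intro Max_ge) auto
    qed
    have "colorable (parcs G) W (Suc (g (clique_number G')))"
      if W: "W \<subseteq> pverts G'" and pat: "\<forall>A b S. \<not> K2r_pattern (parcs G) W r A b S" for W
    proof (rule degenerate_colorable[OF _ E])
      show "finite W" using W fin by (rule finite_subset)
      fix U assume U: "U \<subseteq> W" "U \<noteq> {}"
      have "\<not> K2r_pattern (parcs G) U r A b S" for A b S
        using pat K2r_pattern_mono[OF _ U(1)] by blast
      moreover have "finite U" using U(1) W fin by (meson finite_subset)
      ultimately have "K2r_clique_free (parcs G) U r (clique_number G')"
        using E omega U(1) W by (auto simp: K2r_clique_free_def)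
      with g U(2) show "\<exists>d\<in>U. card {y\<in>U. (d, y) \<in> parcs G} \<le> g (clique_number G')"
        by simp
    qed
    moreover have "\<not> cone_pattern (parcs G) (pverts G') r"
      using assms(2)[OF \<open>G \<in> \<G>\<close>] cone_pattern_mono[OF _ V] by blast
    ultimately have "colorable (parcs G) (pverts G') (2 * Suc (g (clique_number G')))"
      by (intro cone_free_colorable[OF fin E(1), of r] E(2)) auto
    then obtain c where "c ` pverts G' \<subseteq> {..<2 * Suc (g (clique_number G'))}"
      "\<forall>x\<in>pverts G'. \<forall>y\<in>pverts G'. (x, y) \<in> parcs G \<longrightarrow> c x \<noteq> c y"
      unfolding colorable_def by auto
    then have "proper_coloring G' (2 * Suc (g (clique_number G'))) c"
      using A by (auto simp: proper_coloring_def)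
    then have "\<exists>c. proper_coloring G' (2 * Suc (g (clique_number G'))) c"
      by (rule exI[of _ c])
    then show ?thesis unfolding chromatic_number_def by (rule Least_le)
  qed
  then show ?thesis
    unfolding chi_bounded_def by (intro exI[of _ "\<lambda>w. 2 * Suc (g w)"] ballI allI impI)
qed

theorem corollary4p14:
  fixes H :: "'b pair_pre_digraph"
  assumes "pair_graph H"
    and "is_induced_subgraph_of H W4
       \<or> is_induced_subgraph_of H K5_minus
       \<or> (\<exists>q. is_induced_subgraph_of H (K2q q))
       \<or> (\<exists>q\<ge>1. is_induced_subgraph_of H (K2q_plus q))"
  shows "chi_bounded (induced_minor_free_graphs H :: 'a pair_pre_digraph set)"
proof -
  obtain q X where X: "X \<in> {W4, K5_minus, K2q q, K2q_plus q}" "is_induced_subgraph_of H X"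
    using assms(2) by blast
  have "\<not> cone_pattern (parcs G) (pverts G) (q + 3)" if "G \<in> induced_minor_free_graphs H"
    for G :: "'a pair_pre_digraph"
  proof
    assume cone: "cone_pattern (parcs G) (pverts G) (q + 3)"
    have G: "pair_graph G" "\<not> is_induced_minor_of H G"
      using that by (auto simp: induced_minor_free_graphs_def)
    have "\<exists>\<phi>. induced_minor_model X G \<phi>"
      using cone G(1) X(1) by (rule cone_pattern_models)
    then obtain \<phi> where \<phi>: "induced_minor_model X G \<phi>" ..
    have "pair_graph X" using X(1) pair_graph_particular by auto
    from model_induced_subgraph[OF X(2) \<phi> this] obtain \<psi> where "induced_minor_model H G \<psi>" ..
    from model_is_induced_minor[OF G(1) assms(1) this] G(2) show False by simp
  qed
  moreover have "pair_graph G" if "G \<in> induced_minor_free_graphs H" for G :: "'a pair_pre_digraph"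
    using that by (simp add: induced_minor_free_graphs_def)
  ultimately show ?thesis by (intro cone_free_chi_bounded[of _ "q + 3"])
qed

end
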